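(* Let $G$ be a simple, undirected, non-regular graph with non-negative link weights, and let $q$ be its spectral degree exponent. (a) If $G$ is biregular, then $q=2$. (b) If $G$ is connected and $q=2$, then $G$ is biregular.
   Context: $G$ is a finite simple undirected graph (no self-loops, no multiple links) on $N$ nodes with non-negatively weighted links. It is represented by its weighted adjacency matrix $A=(a_{ij})$, a real symmetric $N\times N$ matrix with non-negative entries and zero diagonal; two nodes $i,j$ are adjacent when $a_{ij}>0$, and connectedness and bipartiteness refer to this adjacency. An unweighted graph is the case where all weights are $1$. The weighted degree of node $i$ is $d_i=\sum_{j=1}^N a_{ij}$, and $d_{\max}=\max_i d_i$. $G$ is non-regular if not all weighted degrees are equal. The spectral radius $\lambda_1$ is the largest eigenvalue of $A$. Spectral degree exponent (SDE): for non-regular (possibly disconnected and weighted) $G$, the SDE is the solution $q$ of $$\lambda_1=\left(\frac1N\sum_{i=1}^N d_i^{\,q}\right)^{1/q}.$$ It is a known fact that this solution exists, is unique and lies in $[2,\infty]$. For $q=\infty$ the right-hand side is understood as its limit $d_{\max}$, i.e. $q=\infty$ means $\lambda_1=d_{\max}$. $G$ is biregular (semiregular bipartite) if it is bipartite, with a partition of the nodes into two groups, every link joining different groups, such that all nodes in the same group have the same weighted degree. *)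

theory Defs
  imports "HOL-Analysis.Analysis"
begin

text \<open>
  A weighted graph on \<open>N = CARD('n)\<close> nodes is given by its weighted adjacency matrix
  \<open>A :: real^'n^'n\<close>, where \<open>A $ i $ j\<close> is the weight of the link between \<open>i\<close> and \<open>j\<close>.
\<close>

definition weighted_graph :: "real^'n^'n \<Rightarrow> bool" where
  "weighted_graph A \<longleftrightarrow>
     (\<forall>i j. A $ i $ j = A $ j $ i) \<and> (\<forall>i j. 0 \<le> A $ i $ j) \<and> (\<forall>i. A $ i $ i = 0)"

definition adjacent :: "real^'n^'n \<Rightarrow> 'n \<Rightarrow> 'n \<Rightarrow> bool" where
  "adjacent A i j \<longleftrightarrow> A $ i $ j > 0"

definition connected_graph :: "real^'n^'n \<Rightarrow> bool" where
  "connected_graph A \<longleftrightarrow> (\<forall>i j. rtranclp (adjacent A) i j)"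

definition wdegree :: "real^'n^'n \<Rightarrow> 'n \<Rightarrow> real" where
  "wdegree A i = (\<Sum>j\<in>UNIV. A $ i $ j)"

definition max_wdegree :: "real^'n^'n \<Rightarrow> real" where
  "max_wdegree A = Max (range (wdegree A))"

definition regular_graph :: "real^'n^'n \<Rightarrow> bool" where
  "regular_graph A \<longleftrightarrow> (\<forall>i j. wdegree A i = wdegree A j)"

definition bipartition :: "real^'n^'n \<Rightarrow> 'n set \<Rightarrow> 'n set \<Rightarrow> bool" where
  "bipartition A X Y \<longleftrightarrow> X \<union> Y = UNIV \<and> X \<inter> Y = {} \<and>
     (\<forall>i j. adjacent A i j \<longrightarrow> (i \<in> X \<and> j \<in> Y) \<or> (i \<in> Y \<and> j \<in> X))"

text \<open>
  The two groups are not required to be nonempty: in a non-regular graph, groups of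
  constant degree are automatically both nonempty.
\<close>

definition biregular :: "real^'n^'n \<Rightarrow> bool" where
  "biregular A \<longleftrightarrow> (\<exists>X Y. bipartition A X Y \<and>
     (\<forall>i\<in>X. \<forall>j\<in>X. wdegree A i = wdegree A j) \<and>
     (\<forall>i\<in>Y. \<forall>j\<in>Y. wdegree A i = wdegree A j))"

definition eigenvalue :: "real^'n^'n \<Rightarrow> real \<Rightarrow> bool" where
  "eigenvalue A l \<longleftrightarrow> (\<exists>v. v \<noteq> 0 \<and> A *v v = l *\<^sub>R v)"

text \<open>
  The largest eigenvalue; for symmetric \<open>A\<close> the set of real eigenvalues is finite and
  nonempty, so that \<open>Max\<close> is meaningful.
\<close>

definition spectral_radius :: "real^'n^'n \<Rightarrow> real" where
  "spectral_radius A = Max {l. eigenvalue A l}"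

definition degree_power_mean :: "real^'n^'n \<Rightarrow> real \<Rightarrow> real" where
  "degree_power_mean A p =
     (1 / real CARD('n) * (\<Sum>i\<in>UNIV. wdegree A i powr p)) powr (1 / p)"

text \<open>
  \<open>q\<close> solves the equation that defines the spectral degree exponent.  A finite \<open>q\<close> is only
  required to be such that the power mean makes sense: it is undefined for \<open>p = 0\<close>, and for
  \<open>p < 0\<close> if some degree is zero, where Isabelle's conventions \<open>1 / 0 = 0\<close> and
  \<open>0 powr p = 0\<close> would otherwise give it a spurious value.  For \<open>q = \<infinity>\<close> the power mean is
  replaced by its limit, the maximum degree.
\<close>

definition spectral_degree_exponent :: "real^'n^'n \<Rightarrow> ereal \<Rightarrow> bool" where
  "spectral_degree_exponent A q \<longleftrightarrow>
     (\<exists>p::real. q = ereal p \<and> p \<noteq> 0 \<and> (p < 0 \<longrightarrow> (\<forall>i. 0 < wdegree A i)) \<and>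
        spectral_radius A = degree_power_mean A p) \<or>
     (q = \<infinity> \<and> spectral_radius A = max_wdegree A)"

end

theory Submission
  imports Defs
begin

text \<open>
  (a) If the two groups have degrees \<open>a \<noteq> b\<close>, then \<open>sqrt a\<close>, \<open>sqrt b\<close> on the groups is a
  positive eigenvector, so \<open>\<lambda>\<^sub>1 = sqrt (a * b)\<close>.  Double counting the total weight gives the
  groups sizes in proportion \<open>b : a\<close>; writing \<open>a = exp (s + t)\<close>, \<open>b = exp (s - t)\<close>, the equation
  for the exponent \<open>p\<close> becomes \<open>cosh ((p - 1) * t) = cosh t\<close>, so that \<open>p = 2\<close> or \<open>p = 0\<close>.

  (b) \<open>\<lambda>\<^sub>1\<^sup>2\<close> is the maximum of the Rayleigh quotient of \<open>A\<^sup>2\<close>.  For \<open>q = 2\<close> the all-one vector attains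
  it, hence is an eigenvector of \<open>A\<^sup>2\<close>; that is, \<open>A d\<close> is constantly \<open>\<lambda>\<^sub>1\<^sup>2\<close> for the degree vector \<open>d\<close>.
  Comparing this equation at nodes of maximum and of minimum degree, all neighbours of the former
  have minimum degree and vice versa, and by connectedness there are no other nodes.
\<close>

section \<open>The spectral radius of a nonnegative symmetric matrix\<close>

lemma symmetric_matrix_inner:
  fixes A :: "real^'n^'n"
  assumes "\<And>i j. A $ i $ j = A $ j $ i"
  shows "(A *v x) \<bullet> y = x \<bullet> (A *v y)"
proof -
  have "transpose A = A"
    using assms by (simp add: transpose_def vec_eq_iff)
  then show ?thesis
    by (metis dot_lmul_matrix inner_commute vector_transpose_matrix)
qed

text \<open>Eigenvectors for distinct eigenvalues are orthogonal, hence independent, and independent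
  sets are finite here. This makes \<open>Max\<close> in \<open>spectral_radius\<close>
  meaningful.\<close>

lemma finite_eigenvalues_symmetric:
  fixes A :: "real^'n^'n"
  assumes "\<And>i j. A $ i $ j = A $ j $ i"
  shows "finite {l. eigenvalue A l}"
proof -
  let ?E = "{l. eigenvalue A l}"
  obtain v where v: "\<And>l. l \<in> ?E \<Longrightarrow> v l \<noteq> 0 \<and> A *v v l = l *\<^sub>R v l"
    using bchoice[of ?E "\<lambda>l v. v \<noteq> 0 \<and> A *v v = l *\<^sub>R v"] by (auto simp: eigenvalue_def)
  have orth: "v k \<bullet> v l = 0" if "k \<in> ?E" "l \<in> ?E" "k \<noteq> l" for k l
  proof -
    have "k * (v k \<bullet> v l) = l * (v k \<bullet> v l)"
      using symmetric_matrix_inner[OF assms, of "v k" "v l"] v that by simp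
    then show ?thesis
      using that by simp
  qed
  have "inj_on v ?E"
    by (metis inj_onI inner_eq_zero_iff orth v)
  moreover have "independent (v ` ?E)"
  proof (rule pairwise_orthogonal_independent)
    show "pairwise orthogonal (v ` ?E)"
      unfolding pairwise_def orthogonal_def using orth by blast
    show "0 \<notin> v ` ?E"
      using v by force
  qed
  ultimately show ?thesis
    using finite_imageD independent_imp_finite by blast
qed

lemma abs_matrix_vector_mult_le:
  fixes A :: "real^'n^'n"
  assumes "\<And>i j. 0 \<le> A $ i $ j"
  shows "\<bar>(A *v x) $ i\<bar> \<le> (A *v (\<chi> j. \<bar>x $ j\<bar>)) $ i"
proof -
  have "\<bar>\<Sum>j\<in>UNIV. A $ i $ j * x $ j\<bar> \<le> (\<Sum>j\<in>UNIV. \<bar>A $ i $ j * x $ j\<bar>)"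
    by (rule sum_abs)
  then show ?thesis
    using assms by (simp add: matrix_vector_mult_def abs_mult)
qed

text \<open>Easy half of Perron-Frobenius: for an eigenvector \<open>u\<close> of \<open>l\<close>,
  pairing its entrywise absolute value \<open>w\<close> with \<open>v\<close> gives
  \<open>\<bar>l\<bar> * (w \<bullet> v) \<le> c * (w \<bullet> v)\<close>, where
  \<open>w \<bullet> v > 0\<close>.\<close>

lemma spectral_radius_eqI_positive:
  fixes A :: "real^'n^'n"
  assumes sym: "\<And>i j. A $ i $ j = A $ j $ i" and nonneg: "\<And>i j. 0 \<le> A $ i $ j"
    and pos: "\<And>i. 0 < v $ i" and ev: "A *v v = c *\<^sub>R v"
  shows "spectral_radius A = c"
  unfolding spectral_radius_def
proof (rule Max_eqI)
  show "finite {l. eigenvalue A l}"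
    using finite_eigenvalues_symmetric sym by blast
  have "v \<noteq> 0"
    using pos by (metis less_irrefl zero_index)
  then show "c \<in> {l. eigenvalue A l}"
    using ev by (auto simp: eigenvalue_def)
  fix l assume "l \<in> {l. eigenvalue A l}"
  then obtain u where u: "u \<noteq> 0" "A *v u = l *\<^sub>R u"
    by (auto simp: eigenvalue_def)
  define w :: "real^'n" where "w = (\<chi> j. \<bar>u $ j\<bar>)"
  obtain k where "u $ k \<noteq> 0"
    using u(1) by (auto simp: vec_eq_iff)
  then have "0 < w \<bullet> v"
    unfolding inner_vec_def w_def
    by (intro sum_pos2[where i = k]) (auto simp: pos less_imp_le)
  moreover have "\<bar>l\<bar> * (w \<bullet> v) \<le> (A *v w) \<bullet> v"
    unfolding inner_vec_def sum_distrib_left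
  proof (rule sum_mono)
    fix i
    have "\<bar>l\<bar> * w $ i \<le> (A *v w) $ i"
      using abs_matrix_vector_mult_le[OF nonneg, of u i] u(2) by (simp add: w_def abs_mult)
    then show "\<bar>l\<bar> * (w $ i \<bullet> v $ i) \<le> (A *v w) $ i \<bullet> v $ i"
      using pos[of i] by (simp add: mult_right_mono flip: mult.assoc)
  qed
  moreover have "(A *v w) \<bullet> v = c * (w \<bullet> v)"
    using symmetric_matrix_inner[OF sym, of w v] ev by simp
  ultimately show "l \<le> c"
    by simp
qed

text \<open>
  The quadratic form \<open>m * norm x ^ 2 - norm (A x) ^ 2\<close> is positive semidefinite, so wherever it
  vanishes its gradient vanishes, too.
\<close>

lemma maximizer_imp_eigenvector_square:
  fixes A :: "real^'n^'n"
  assumes sym: "\<And>i j. A $ i $ j = A $ j $ i"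
    and bound: "\<And>x. (A *v x) \<bullet> (A *v x) \<le> m * (x \<bullet> x)"
    and eq: "(A *v v) \<bullet> (A *v v) = m * (v \<bullet> v)"
  shows "A *v (A *v v) = m *\<^sub>R v"
proof -
  define h where "h = A *v (A *v v) - m *\<^sub>R v"
  define c where "c = m * (h \<bullet> h) - (A *v h) \<bullet> (A *v h)"
  have c: "0 \<le> c"
    using bound[of h] by (simp add: c_def)
  \<comment> \<open>Expansion of the form at \<open>v + t *\<^sub>R h\<close>: the constant term
    vanishes by \<open>eq\<close>, and \<open>h\<close> is chosen so that the linear term is
    \<open>- 2 * t * (h \<bullet> h)\<close>.\<close>
  have key: "2 * t * (h \<bullet> h) \<le> t\<^sup>2 * c" for t
  proof -
    have "(A *v v) \<bullet> (A *v h) = (A *v (A *v v)) \<bullet> h"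
      using symmetric_matrix_inner[OF sym] by metis
    then have *: "(A *v v) \<bullet> (A *v h) - m * (v \<bullet> h) = h \<bullet> h"
      by (simp add: h_def inner_diff_left)
    have "(A *v v) \<bullet> (A *v v) + 2 * t * ((A *v v) \<bullet> (A *v h)) + t\<^sup>2 * ((A *v h) \<bullet> (A *v h))
        \<le> m * (v \<bullet> v + 2 * t * (v \<bullet> h) + t\<^sup>2 * (h \<bullet> h))"
      using bound[of "v + t *\<^sub>R h"]
      by (simp add: inner_commute power2_eq_square algebra_simps)
    then have "2 * t * ((A *v v) \<bullet> (A *v h) - m * (v \<bullet> h)) \<le> t\<^sup>2 * c"
      by (simp add: eq c_def algebra_simps)
    then show ?thesis
      by (simp add: *)
  qed
  have "h \<bullet> h \<le> 0"
  proof (cases "c = 0")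
    case True
    then show ?thesis using key[of 1] by simp
  next
    case False
    \<comment> \<open>This \<open>t\<close> minimizes
      \<open>t\<^sup>2 * c - 2 * t * (h \<bullet> h)\<close>.\<close>
    then show ?thesis
      using c key[of "(h \<bullet> h) / c"]
      by (simp add: power2_eq_square field_simps) (simp add: mult_le_0_iff)
  qed
  then have "h = 0"
    by (metis inner_eq_zero_iff inner_ge_zero order_antisym)
  then show ?thesis
    by (simp add: h_def)
qed

section \<open>Operator norm and spectral radius\<close>

lemma norm_matrix_vector_attains_sup:
  fixes A :: "real^'n^'n"
  obtains v where "v \<bullet> v = 1" "\<And>x. (A *v x) \<bullet> (A *v x) \<le> ((A *v v) \<bullet> (A *v v)) * (x \<bullet> x)"
proof -
  have "sphere (0 :: real^'n) 1 \<noteq> {}"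
    by simp
  moreover have "continuous_on (sphere 0 1) (\<lambda>x. (A *v x) \<bullet> (A *v x))"
    by (intro continuous_intros)
  ultimately obtain v where v: "v \<in> sphere 0 1"
    and max: "\<And>x. x \<in> sphere 0 1 \<Longrightarrow> (A *v x) \<bullet> (A *v x) \<le> (A *v v) \<bullet> (A *v v)"
    using continuous_attains_sup[of "sphere 0 1" "\<lambda>x. (A *v x) \<bullet> (A *v x)"] compact_sphere by blast
  have "(A *v x) \<bullet> (A *v x) \<le> ((A *v v) \<bullet> (A *v v)) * (x \<bullet> x)" for x
  proof (cases "x = 0")
    case False
    then have "(A *v x) \<bullet> (A *v x) / (norm x)\<^sup>2 \<le> (A *v v) \<bullet> (A *v v)"
      using max[of "x /\<^sub>R norm x"]
      by (simp add: matrix_vector_mult_scaleR power2_eq_square field_simps)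
    then show ?thesis
      using False by (simp add: field_simps dot_square_norm)
  qed simp
  moreover have "v \<bullet> v = 1"
    using v by (simp add: dot_square_norm)
  ultimately show thesis
    using that by blast
qed

text \<open>The operator norm \<open>m\<close> is itself an eigenvalue, not merely up to sign: by
  nonnegativity a maximizer \<open>u\<close> may be replaced by its entrywise absolute value
  \<open>v\<close>, which is then an eigenvector of the square of \<open>A\<close>.\<close>

lemma norm_matrix_vector_le_spectral_radius:
  fixes A :: "real^'n^'n"
  assumes sym: "\<And>i j. A $ i $ j = A $ j $ i" and nonneg: "\<And>i j. 0 \<le> A $ i $ j"
  shows "(A *v x) \<bullet> (A *v x) \<le> (spectral_radius A)\<^sup>2 * (x \<bullet> x)"
proof -
  obtain u where u: "u \<bullet> u = 1"
    and max: "\<And>x. (A *v x) \<bullet> (A *v x) \<le> ((A *v u) \<bullet> (A *v u)) * (x \<bullet> x)"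
    using norm_matrix_vector_attains_sup[of A] by blast
  define m where "m = norm (A *v u)"
  have m: "0 \<le> m" "(A *v u) \<bullet> (A *v u) = m\<^sup>2"
    by (simp_all add: m_def dot_square_norm)
  define v :: "real^'n" where "v = (\<chi> j. \<bar>u $ j\<bar>)"
  have v: "v \<bullet> v = 1"
    using u by (simp add: v_def inner_vec_def)
  have "(A *v u) \<bullet> (A *v u) \<le> (A *v v) \<bullet> (A *v v)"
    unfolding inner_vec_def
  proof (rule sum_mono)
    fix i
    have "\<bar>(A *v u) $ i\<bar> \<le> \<bar>(A *v v) $ i\<bar>"
      using abs_matrix_vector_mult_le[OF nonneg, of u i] by (simp add: v_def)
    then show "(A *v u) $ i \<bullet> (A *v u) $ i \<le> (A *v v) $ i \<bullet> (A *v v) $ i"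
      by (simp add: abs_le_square_iff flip: power2_eq_square)
  qed
  with max[of v] v m have "(A *v v) \<bullet> (A *v v) = m\<^sup>2 * (v \<bullet> v)"
    by simp
  then have sq: "A *v (A *v v) = m\<^sup>2 *\<^sub>R v"
    using maximizer_imp_eigenvector_square[OF sym, of "m\<^sup>2" v] max m by simp
  have "eigenvalue A m"
  \<comment> \<open>For \<open>m = 0\<close> the vector \<open>w\<close> of the other case would be
    zero, but then \<open>v\<close> itself lies in the kernel of \<open>A\<close>.\<close>
  proof (cases "m = 0")
    case True
    with max[of v] m have "A *v v = m *\<^sub>R v"
      by (metis inner_eq_zero_iff inner_ge_zero mult_zero_left order_antisym power_zero_numeral
          scaleR_zero_left)
    moreover have "v \<noteq> 0"
      using v by auto
    ultimately show ?thesis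
      by (auto simp: eigenvalue_def)
  next
    case False
    \<comment> \<open>Since \<open>(A - m) (A + m) v = 0\<close>, the vector
      \<open>(A + m) v\<close> is an eigenvector for \<open>m\<close> unless it vanishes; both of
      its summands are entrywise nonnegative, so they cannot cancel.\<close>
    define w where "w = A *v v + m *\<^sub>R v"
    have "A *v w = m *\<^sub>R w"
      by (simp add: w_def sq matrix_vector_right_distrib matrix_vector_mult_scaleR
          power2_eq_square algebra_simps)
    moreover have "w \<noteq> 0"
    proof
      assume "w = 0"
      have "v = 0"
      proof (subst vec_eq_iff, intro allI)
        fix i
        have "0 \<le> (A *v v) $ i"
          using nonneg by (simp add: matrix_vector_mult_def v_def sum_nonneg)
        moreover have "(A *v v) $ i + m * v $ i = 0"
          using \<open>w = 0\<close> by (simp add: w_def vec_eq_iff)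
        moreover have "0 \<le> m * v $ i"
          using m by (simp add: v_def)
        ultimately have "m * v $ i = 0"
          by linarith
        then show "v $ i = 0 $ i"
          using False by simp
      qed
      with v show False by simp
    qed
    ultimately show ?thesis
      by (auto simp: eigenvalue_def)
  qed
  then have "m \<le> spectral_radius A"
    unfolding spectral_radius_def using finite_eigenvalues_symmetric[OF sym] by simp
  then have "m\<^sup>2 * (x \<bullet> x) \<le> (spectral_radius A)\<^sup>2 * (x \<bullet> x)"
    using m by (intro mult_right_mono power_mono) auto
  with max[of x] m show ?thesis
    by simp
qed

section \<open>Biregular graphs\<close>

lemma cosh_real_eq_iff_abs: "cosh x = cosh y \<longleftrightarrow> \<bar>x\<bar> = \<bar>y\<bar>" for x y :: real
  using cosh_real_nonneg_le_iff[OF abs_ge_zero abs_ge_zero, of x y]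
    cosh_real_nonneg_le_iff[OF abs_ge_zero abs_ge_zero, of y x]
  by (simp only: cosh_real_abs) linarith

text \<open>Here \<open>eq\<close> is the equation of the exponent, raised to the power
  \<open>p\<close> and cleared of denominators, for degrees \<open>a\<close> and \<open>b\<close>
  with frequencies in proportion \<open>b : a\<close>.\<close>

lemma two_valued_power_mean_exponent:
  fixes a b p :: real
  assumes "0 < a" "0 < b" "a \<noteq> b" "p \<noteq> 0"
    and eq: "b * a powr p + a * b powr p = (a + b) * sqrt (a * b) powr p"
  shows "p = 2"
proof -
  define s where "s = (ln a + ln b) / 2"
  define t where "t = (ln a - ln b) / 2"
  have a: "a = exp (s + t)" and b: "b = exp (s - t)"
    using assms by (simp_all add: s_def t_def field_simps)
  have "t \<noteq> 0"
    using assms by (simp add: t_def)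
  have "sqrt (a * b) = exp s"
    by (rule real_sqrt_unique) (simp_all add: a b power2_eq_square flip: exp_add)
  then have pow: "a powr p = exp (p * (s + t))" "b powr p = exp (p * (s - t))"
      "sqrt (a * b) powr p = exp (p * s)"
    by (simp_all add: a b powr_def)
  \<comment> \<open>Both sides contain the factor \<open>exp (s + p * s)\<close>; what remains is
    twice a \<open>cosh\<close>.\<close>
  have "exp (s - t + p * (s + t)) + exp (s + t + p * (s - t))
      = exp (s + t + p * s) + exp (s - t + p * s)"
    using eq unfolding pow unfolding a b by (simp add: distrib_right flip: exp_add)
  moreover have "exp (s - t + p * (s + t)) + exp (s + t + p * (s - t))
      = exp (s + p * s) * (2 * cosh ((p - 1) * t))"
    by (simp add: cosh_def algebra_simps flip: exp_add)
  moreover have "exp (s + t + p * s) + exp (s - t + p * s) = exp (s + p * s) * (2 * cosh t)"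
    by (simp add: cosh_def algebra_simps flip: exp_add)
  ultimately have "cosh ((p - 1) * t) = cosh t"
    by simp
  then have "\<bar>p - 1\<bar> = 1"
    using \<open>t \<noteq> 0\<close> by (simp add: cosh_real_eq_iff_abs abs_mult)
  with \<open>p \<noteq> 0\<close> show ?thesis
    by linarith
qed

text \<open>Both sums count the total weight of the links between \<open>X\<close> and
  \<open>Y\<close>.\<close>

lemma bipartition_sum_wdegree:
  fixes A :: "real^'n^'n"
  assumes "weighted_graph A" "bipartition A X Y"
  shows "sum (wdegree A) X = sum (wdegree A) Y"
proof -
  have zero: "A $ i $ j = 0" if "i \<in> X \<and> j \<in> X \<or> i \<in> Y \<and> j \<in> Y" for i j
    using assms that unfolding weighted_graph_def bipartition_def adjacent_def
    by (metis disjoint_iff order_le_less)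
  have "wdegree A i = (\<Sum>j\<in>Y. A $ i $ j)" if "i \<in> X" for i
    unfolding wdegree_def using assms(2) that zero
    by (intro sum.mono_neutral_right) (auto simp: bipartition_def)
  moreover have "wdegree A i = (\<Sum>j\<in>X. A $ i $ j)" if "i \<in> Y" for i
    unfolding wdegree_def using assms(2) that zero
    by (intro sum.mono_neutral_right) (auto simp: bipartition_def)
  moreover have "(\<Sum>i\<in>X. \<Sum>j\<in>Y. A $ i $ j) = (\<Sum>i\<in>Y. \<Sum>j\<in>X. A $ i $ j)"
    using assms(1) by (subst sum.swap) (simp add: weighted_graph_def)
  ultimately show ?thesis
    by simp
qed

text \<open>All neighbours of a node in \<open>X\<close> carry \<open>sqrt b\<close>, so
  \<open>A\<close> maps \<open>?v\<close> there to
  \<open>a * sqrt b = sqrt (a * b) * sqrt a\<close>; likewise on \<open>Y\<close>.\<close>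

lemma spectral_radius_biregular:
  fixes A :: "real^'n^'n"
  assumes wg: "weighted_graph A" and bip: "bipartition A X Y"
    and dX: "\<And>i. i \<in> X \<Longrightarrow> wdegree A i = a" and dY: "\<And>i. i \<in> Y \<Longrightarrow> wdegree A i = b"
    and "0 < a" "0 < b"
  shows "spectral_radius A = sqrt (a * b)"
proof (rule spectral_radius_eqI_positive)
  let ?v = "(\<chi> i. if i \<in> X then sqrt a else sqrt b) :: real^'n"
  show "A $ i $ j = A $ j $ i" "0 \<le> A $ i $ j" for i j
    using wg by (auto simp: weighted_graph_def)
  show "0 < ?v $ i" for i
    using \<open>0 < a\<close> \<open>0 < b\<close> by simp
  show "A *v ?v = sqrt (a * b) *\<^sub>R ?v"
  proof (subst vec_eq_iff, intro allI)
    fix i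
    have zero: "A $ i $ j = 0" if "i \<in> X \<longleftrightarrow> j \<in> X" for j
      using wg bip that unfolding weighted_graph_def bipartition_def adjacent_def
      by (metis disjoint_iff order_le_less)
    have "A $ i $ j * ?v $ j = (if i \<in> X then sqrt b else sqrt a) * A $ i $ j" for j
      using zero[of j] by auto
    then have "(A *v ?v) $ i = (if i \<in> X then sqrt b else sqrt a) * wdegree A i"
      unfolding matrix_vector_mult_def wdegree_def sum_distrib_left vec_lambda_beta
      by (intro sum.cong) auto
    moreover have "wdegree A i = (if i \<in> X then sqrt a * sqrt a else sqrt b * sqrt b)"
      using dX dY bip \<open>0 < a\<close> \<open>0 < b\<close> by (auto simp: bipartition_def)
    ultimately show "(A *v ?v) $ i = (sqrt (a * b) *\<^sub>R ?v) $ i"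
      by (simp add: real_sqrt_mult)
  qed
qed

lemma spectral_degree_exponent_biregular:
  fixes A :: "real^'n^'n"
  assumes wg: "weighted_graph A" and nreg: "\<not> regular_graph A" and "biregular A"
    and sde: "spectral_degree_exponent A q"
  shows "q = 2"
proof -
  obtain X Y where bip: "bipartition A X Y"
    and cX: "\<And>i j. i \<in> X \<Longrightarrow> j \<in> X \<Longrightarrow> wdegree A i = wdegree A j"
    and cY: "\<And>i j. i \<in> Y \<Longrightarrow> j \<in> Y \<Longrightarrow> wdegree A i = wdegree A j"
    using \<open>biregular A\<close> unfolding biregular_def by blast
  have XY: "X \<union> Y = UNIV" "X \<inter> Y = {}"
    using bip by (auto simp: bipartition_def)
  have "X \<noteq> {}" "Y \<noteq> {}"
    using nreg XY cX cY unfolding regular_graph_def by blast+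
  then obtain x y where "x \<in> X" "y \<in> Y"
    by blast
  define a where "a = wdegree A x"
  define b where "b = wdegree A y"
  have dX: "wdegree A i = a" if "i \<in> X" for i
    unfolding a_def using cX that \<open>x \<in> X\<close> by blast
  have dY: "wdegree A i = b" if "i \<in> Y" for i
    unfolding b_def using cY that \<open>y \<in> Y\<close> by blast
  have "a \<noteq> b"
    using nreg XY dX dY unfolding regular_graph_def by (metis UNIV_I Un_iff)
  have cards: "real (card X) * a = real (card Y) * b"
    using bipartition_sum_wdegree[OF wg bip] by (simp add: dX dY)
  have cpos: "0 < card X" "0 < card Y"
    using \<open>X \<noteq> {}\<close> \<open>Y \<noteq> {}\<close> by (simp_all add: card_gt_0_iff)
  have "0 \<le> a" "0 \<le> b"
    using wg by (auto simp: a_def b_def wdegree_def weighted_graph_def sum_nonneg)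
  \<comment> \<open>By \<open>cards\<close>, if one degree were zero, so would be the other.\<close>
  moreover have "a \<noteq> 0" "b \<noteq> 0"
    using cards cpos \<open>a \<noteq> b\<close> by auto
  ultimately have pos: "0 < a" "0 < b"
    by auto
  have rho: "spectral_radius A = sqrt (a * b)"
    using spectral_radius_biregular[OF wg bip dX dY pos] by blast
  have split: "(\<Sum>i\<in>UNIV. f (wdegree A i)) = card X * f a + card Y * f b" for f :: "real \<Rightarrow> real"
    using XY by (simp add: dX dY sum.union_disjoint flip: XY(1))
  have N: "real CARD('n) = card X + card Y"
    using XY by (simp add: card_Un_disjoint flip: XY(1))
  from sde consider p where "q = ereal p" "p \<noteq> 0" "spectral_radius A = degree_power_mean A p"
    | "spectral_radius A = max_wdegree A"
    unfolding spectral_degree_exponent_def by blast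
  then show ?thesis
  proof cases
    case 1
    \<comment> \<open>Positivity of the mean lets the exponents \<open>1 / p\<close> and
      \<open>p\<close> cancel.\<close>
    have "0 < (card X * a powr p + card Y * b powr p) / (card X + card Y)"
      using pos cpos by (intro divide_pos_pos add_pos_pos mult_pos_pos) auto
    then have "sqrt (a * b) powr p = (card X * a powr p + card Y * b powr p) / (card X + card Y)"
      using 1 rho split[of "\<lambda>d. d powr p"] N
      by (simp add: degree_power_mean_def powr_powr)
    then have "(card X + card Y) * sqrt (a * b) powr p = card X * a powr p + card Y * b powr p"
      using cpos by (simp add: field_simps)
    \<comment> \<open>Double counting eliminates \<open>card Y\<close> and leaves the frequencies
      \<open>b : a\<close>.\<close>
    moreover have "real (card Y) = card X * a / b"
      using cards pos by (simp add: field_simps)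
    ultimately have "card X * ((a + b) * sqrt (a * b) powr p)
        = card X * (b * a powr p + a * b powr p)"
      using pos by (simp add: field_simps)
    then have "p = 2"
      using two_valued_power_mean_exponent[of a b p] pos \<open>a \<noteq> b\<close> \<open>p \<noteq> 0\<close> \<open>X \<noteq> {}\<close> by simp
    then show ?thesis
      using 1 by simp
  next
    case 2
    \<comment> \<open>The value \<open>\<infinity>\<close> is impossible: the geometric mean of
      \<open>a\<close> and \<open>b\<close> would be at least their maximum.\<close>
    have "a \<le> sqrt (a * b)" "b \<le> sqrt (a * b)"
      using 2 rho by (simp_all add: max_wdegree_def a_def b_def)
    then have "a\<^sup>2 \<le> a * b" "b\<^sup>2 \<le> a * b"
      using pos by (simp_all add: real_le_rsqrt sqrt_ge_absD)
    then have "a = b"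
      using pos by (simp add: power2_eq_square)
    with \<open>a \<noteq> b\<close> show ?thesis
      by simp
  qed
qed

section \<open>From exponent 2 to biregularity\<close>

lemma biregular_if_neighbour_degrees_constant:
  fixes A :: "real^'n^'n"
  assumes wg: "weighted_graph A" and nreg: "\<not> regular_graph A" and conn: "connected_graph A"
    and nbr: "\<And>i. (\<Sum>j\<in>UNIV. A $ i $ j * wdegree A j) = c"
  shows "biregular A"
proof -
  let ?d = "wdegree A"
  define D where "D = Max (range ?d)"
  define d where "d = Min (range ?d)"
  have bnd: "d \<le> ?d i" "?d i \<le> D" for i
    by (simp_all add: d_def D_def)
  have "D \<in> range ?d" "d \<in> range ?d"
    unfolding D_def d_def by (intro Max_in Min_in; simp)+
  then obtain x y where x: "?d x = D" and y: "?d y = d"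
    by (metis imageE)
  have "D \<noteq> d"
    using nreg bnd unfolding regular_graph_def by (metis order_antisym)
  have A: "0 \<le> A $ i $ j" for i j
    using wg by (simp add: weighted_graph_def)
  have lower: "(\<Sum>j\<in>UNIV. A $ i $ j * (?d j - d)) = c - ?d i * d" for i
    using nbr[of i] by (simp add: right_diff_distrib sum_subtractf wdegree_def sum_distrib_right)
  have upper: "(\<Sum>j\<in>UNIV. A $ i $ j * (D - ?d j)) = ?d i * D - c" for i
    using nbr[of i] by (simp add: right_diff_distrib sum_subtractf wdegree_def sum_distrib_right)
  have nonneg: "0 \<le> A $ i $ j * (?d j - d)" "0 \<le> A $ i $ j * (D - ?d j)" for i j
    using A bnd by simp_all
  \<comment> \<open>A node of maximum degree forces \<open>c \<ge> D * d\<close>, one of minimum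
    degree \<open>c \<le> d * D\<close>. With equality, the nonnegative terms of
    \<open>lower\<close> at degree \<open>D\<close> and of \<open>upper\<close> at degree
    \<open>d\<close> all vanish.\<close>
  have "0 \<le> c - D * d" "0 \<le> d * D - c"
    using lower[of x] upper[of y] x y
      sum_nonneg[of UNIV "\<lambda>j. A $ x $ j * (?d j - d)"]
      sum_nonneg[of UNIV "\<lambda>j. A $ y $ j * (D - ?d j)"] nonneg by simp_all
  then have c: "c = D * d"
    by (simp add: mult.commute)
  have toY: "?d j = d" if "?d i = D" "adjacent A i j" for i j
  proof -
    have "(\<Sum>j\<in>UNIV. A $ i $ j * (?d j - d)) = 0"
      using lower[of i] c that by simp
    then have "A $ i $ j * (?d j - d) = 0"
      using nonneg by (subst (asm) sum_nonneg_eq_0_iff) auto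
    with that show ?thesis
      by (simp add: adjacent_def)
  qed
  have toX: "?d j = D" if "?d i = d" "adjacent A i j" for i j
  proof -
    have "(\<Sum>j\<in>UNIV. A $ i $ j * (D - ?d j)) = 0"
      using upper[of i] c that by simp
    then have "A $ i $ j * (D - ?d j) = 0"
      using nonneg by (subst (asm) sum_nonneg_eq_0_iff) auto
    with that show ?thesis
      by (simp add: adjacent_def)
  qed
  \<comment> \<open>Along any walk from \<open>x\<close> the degrees alternate between
    \<open>D\<close> and \<open>d\<close>.\<close>
  have all: "?d i = D \<or> ?d i = d" for i
  proof -
    have "(adjacent A)\<^sup>*\<^sup>* x i"
      using conn by (simp add: connected_graph_def)
    then show ?thesis
    proof induction
      case base
      show ?case using x by blast
    next
      case (step j k)
      then show ?case using toX toY by blast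
    qed
  qed
  let ?X = "{i. ?d i = D}" and ?Y = "{i. ?d i = d}"
  have "bipartition A ?X ?Y"
    unfolding bipartition_def
  proof (intro conjI allI impI)
    fix i j assume "adjacent A i j"
    then show "i \<in> ?X \<and> j \<in> ?Y \<or> i \<in> ?Y \<and> j \<in> ?X"
      using all[of i] toX toY by blast
  qed (use all \<open>D \<noteq> d\<close> in auto)
  then show ?thesis
    unfolding biregular_def by (intro exI[of _ ?X] exI[of _ ?Y]) simp
qed

text \<open>The squared quadratic mean of the degrees is the Rayleigh quotient of the square of
  \<open>A\<close> at the all-one vector, so exponent 2 says that this vector attains the bound by
  \<open>?r\<^sup>2\<close>.\<close>

lemma biregular_if_spectral_degree_exponent_2:
  fixes A :: "real^'n^'n"
  assumes wg: "weighted_graph A" and "\<not> regular_graph A" "connected_graph A"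
    and sde: "spectral_degree_exponent A 2"
  shows "biregular A"
proof -
  have sym: "A $ i $ j = A $ j $ i" and nonneg: "0 \<le> A $ i $ j" for i j
    using wg by (simp_all add: weighted_graph_def)
  let ?r = "spectral_radius A"
  let ?one = "(\<chi> i. 1) :: real^'n"
  have A1: "(A *v ?one) $ i = wdegree A i" for i
    by (simp add: matrix_vector_mult_def wdegree_def)
  \<comment> \<open>This form of 2 excludes the disjunct for \<open>\<infinity>\<close> and
    identifies the real exponent.\<close>
  have "(2 :: ereal) = ereal 2"
    by simp
  then have "?r = degree_power_mean A 2"
    using sde unfolding spectral_degree_exponent_def
    by (metis ereal.inject PInfty_neq_ereal(1))
  moreover have "wdegree A i powr 2 = (wdegree A i)\<^sup>2" for i
    using nonneg by (simp add: wdegree_def sum_nonneg)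
  ultimately have "?r = sqrt (1 / real CARD('n) * (\<Sum>i\<in>UNIV. (wdegree A i)\<^sup>2))"
    by (simp add: degree_power_mean_def powr_half_sqrt sum_nonneg)
  then have "?r\<^sup>2 = 1 / real CARD('n) * (\<Sum>i\<in>UNIV. (wdegree A i)\<^sup>2)"
    by (simp add: sum_nonneg)
  then have "(A *v ?one) \<bullet> (A *v ?one) = ?r\<^sup>2 * (?one \<bullet> ?one)"
    by (simp add: inner_vec_def A1 power2_eq_square)
  then have "A *v (A *v ?one) = ?r\<^sup>2 *\<^sub>R ?one"
    using maximizer_imp_eigenvector_square[OF sym]
      norm_matrix_vector_le_spectral_radius[OF sym nonneg] by blast
  then have "(A *v (A *v ?one)) $ i = ?r\<^sup>2" for i
    by simp
  then have "(\<Sum>j\<in>UNIV. A $ i $ j * wdegree A j) = ?r\<^sup>2" for i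
    by (simp add: A1 matrix_vector_mult_def[of A "A *v ?one"])
  then show ?thesis
    by (rule biregular_if_neighbour_degrees_constant[OF assms(1-3)])
qed

theorem theorem2:
  fixes A :: "real^'n^'n" and q :: ereal
  assumes "weighted_graph A"
    and "\<not> regular_graph A"
    and "spectral_degree_exponent A q"
  shows "(biregular A \<longrightarrow> q = 2) \<and>
         (connected_graph A \<and> q = 2 \<longrightarrow> biregular A)"
proof (intro conjI impI)
  show "q = 2" if "biregular A"
    using assms that by (intro spectral_degree_exponent_biregular)
  show "biregular A" if "connected_graph A \<and> q = 2"
    using assms that by (intro biregular_if_spectral_degree_exponent_2) auto
qed

end
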